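(* Let $i\in\{1,2\}$, $\varepsilon=(-1)^i$, and let $\mathcal{S}_i$ be the timelike general rotational surface of first type ($i=1$) or second type ($i=2$) determined by $f,g,\alpha,\beta$. Let $\lambda_1,\lambda_2,\lambda_3,\lambda_4\in\mathbb{R}$ be not all zero with $\lambda_1+\lambda_2+\lambda_3=\lambda_4$, and equip $\mathbb{E}_1^4$ with the density $e^{\lambda_1x^2+\lambda_2y^2+\lambda_3z^2+\lambda_4t^2}$. Then $\mathcal{S}_i$ is weighted flat if $$\alpha^2\beta^2\left(gf'-fg'\right)^2\left(-\varepsilon f'^2+g'^2\right)+\left(\varepsilon(\alpha f)^2+(\beta g)^2\right)\left(\beta^2gf'+\alpha^2fg'\right)\left(f''g'-f'g''\right)=0$$ holds (for all $u\in J$).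
   Context: $\mathbb{E}_1^4$ is $\mathbb{R}^4$ with coordinates $(x,y,z,t)$ and the metric $dx^2+dy^2+dz^2-dt^2$. Let $\alpha,\beta>0$ be constants, $J\subset\mathbb{R}$ an open interval, $f,g:J\to\mathbb{R}$ smooth functions of $u$ (primes denote $d/du$), and $v\in[0,2\pi)$. First type: $\mathcal{S}_1: X_1(u,v)=(f\cos(\alpha v),f\sin(\alpha v),g\cosh(\beta v),g\sinh(\beta v))$ with $\alpha^2f^2-\beta^2g^2<0$ and $f'^2+g'^2>0$ on $J$. Second type: $\mathcal{S}_2: X_2(u,v)=(f\cos(\alpha v),f\sin(\alpha v),g\sinh(\beta v),g\cosh(\beta v))$ with $f'^2-g'^2<0$ and $\alpha^2f^2+\beta^2g^2>0$ on $J$. Both surfaces are timelike. With $\varepsilon=(-1)^i$, the Gaussian curvature of $\mathcal{S}_i$ is $$K^{\mathcal{S}_i}=\frac{\alpha^2\beta^2(gf'-fg')^2(-\varepsilon f'^2+g'^2)+\left(\varepsilon(\alpha f)^2+(\beta g)^2\right)(\alpha^2fg'+\beta^2gf')(f''g'-f'g'')}{\left((\alpha f)^2+\varepsilon(\beta g)^2\right)^2(-\varepsilon f'^2+g'^2)^2}.$$ For a density $e^\phi$ on $\mathbb{E}_1^4$, the weighted Gaussian curvature is $K_\phi^{\mathcal{S}_i}=K^{\mathcal{S}_i}-\Delta\phi$, where $\Delta$ is the Laplacian of $\mathbb{E}_1^4$, $\Delta\phi=\phi_{xx}+\phi_{yy}+\phi_{zz}-\phi_{tt}$. The surface is weighted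 flat if $K_\phi^{\mathcal{S}_i}$ vanishes identically. *)

theory Defs
  imports "HOL-Analysis.Analysis"
begin

text \<open>Points of \<open>E\<^sub>1\<^sup>4\<close> have coordinates \<open>(x, y, z, t) = (p $ 1, p $ 2, p $ 3, p $ 4)\<close>.\<close>
definition lorentz :: "real ^ 4 \<Rightarrow> real ^ 4 \<Rightarrow> real" where
  "lorentz p q = p $ 1 * q $ 1 + p $ 2 * q $ 2 + p $ 3 * q $ 3 - p $ 4 * q $ 4"

definition partial :: "4 \<Rightarrow> (real ^ 4 \<Rightarrow> real) \<Rightarrow> real ^ 4 \<Rightarrow> real" where
  "partial k \<phi> p = deriv (\<lambda>s. \<phi> (p + s *\<^sub>R axis k 1)) 0"

definition lorentz_laplacian :: "(real ^ 4 \<Rightarrow> real) \<Rightarrow> real ^ 4 \<Rightarrow> real" where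
  "lorentz_laplacian \<phi> p =
     partial 1 (partial 1 \<phi>) p + partial 2 (partial 2 \<phi>) p
     + partial 3 (partial 3 \<phi>) p - partial 4 (partial 4 \<phi>) p"

type_synonym surface = "real \<Rightarrow> real \<Rightarrow> real ^ 4"

definition d_u :: "surface \<Rightarrow> surface" where
  "d_u X u v = vector_derivative (\<lambda>s. X s v) (at u)"

definition d_v :: "surface \<Rightarrow> surface" where
  "d_v X u v = vector_derivative (\<lambda>s. X u s) (at v)"

definition fund_E :: "surface \<Rightarrow> real \<Rightarrow> real \<Rightarrow> real" where
  "fund_E X u v = lorentz (d_u X u v) (d_u X u v)"

definition fund_F :: "surface \<Rightarrow> real \<Rightarrow> real \<Rightarrow> real" where
  "fund_F X u v = lorentz (d_u X u v) (d_v X u v)"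

definition fund_G :: "surface \<Rightarrow> real \<Rightarrow> real \<Rightarrow> real" where
  "fund_G X u v = lorentz (d_v X u v) (d_v X u v)"

definition fund_det :: "surface \<Rightarrow> real \<Rightarrow> real \<Rightarrow> real" where
  "fund_det X u v = fund_E X u v * fund_G X u v - (fund_F X u v)\<^sup>2"

text \<open>
  The component of \<open>w\<close> that is \<^const>\<open>lorentz\<close>-orthogonal to the tangent plane at \<open>X u v\<close>: the
  subtracted term is the tangential projection of \<open>w\<close>, its coefficients being obtained by
  inverting the first fundamental form, which is possible where \<^const>\<open>fund_det\<close> is nonzero
  (on timelike surfaces it is negative).
\<close>
definition normal_part :: "surface \<Rightarrow> real \<Rightarrow> real \<Rightarrow> real ^ 4 \<Rightarrow> real ^ 4" where
  "normal_part X u v w = w -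
     (((fund_G X u v * lorentz w (d_u X u v) - fund_F X u v * lorentz w (d_v X u v))
         / fund_det X u v) *\<^sub>R d_u X u v +
      ((fund_E X u v * lorentz w (d_v X u v) - fund_F X u v * lorentz w (d_u X u v))
         / fund_det X u v) *\<^sub>R d_v X u v)"

definition II_uu :: "surface \<Rightarrow> surface" where
  "II_uu X u v = normal_part X u v (d_u (d_u X) u v)"

definition II_uv :: "surface \<Rightarrow> surface" where
  "II_uv X u v = normal_part X u v (d_v (d_u X) u v)"

definition II_vv :: "surface \<Rightarrow> surface" where
  "II_vv X u v = normal_part X u v (d_v (d_v X) u v)"

text \<open>
  Gauss equation in the flat space \<open>E\<^sub>1\<^sup>4\<close>. In an orthonormal normal frame
  \<open>n\<^sub>1, n\<^sub>2\<close> with signs \<open>\<epsilon>\<^sub>k = lorentz n\<^sub>k n\<^sub>k\<close>, the numerator is the sum of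
  \<open>\<epsilon>\<^sub>k\<close> times the determinant of the second fundamental form in direction \<open>n\<^sub>k\<close>.
\<close>
definition gauss_curvature :: "surface \<Rightarrow> real \<Rightarrow> real \<Rightarrow> real" where
  "gauss_curvature X u v =
     (lorentz (II_uu X u v) (II_vv X u v) - lorentz (II_uv X u v) (II_uv X u v)) / fund_det X u v"

text \<open>Here \<open>\<phi>\<close> is the exponent of the density \<open>exp \<phi>\<close>, not the density itself.\<close>
definition weighted_gauss_curvature ::
    "(real ^ 4 \<Rightarrow> real) \<Rightarrow> surface \<Rightarrow> real \<Rightarrow> real \<Rightarrow> real" where
  "weighted_gauss_curvature \<phi> X u v = gauss_curvature X u v - lorentz_laplacian \<phi> (X u v)"

definition weighted_flat :: "(real ^ 4 \<Rightarrow> real) \<Rightarrow> surface \<Rightarrow> real set \<Rightarrow> real set \<Rightarrow> bool" where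
  "weighted_flat \<phi> X U V \<longleftrightarrow> (\<forall>u\<in>U. \<forall>v\<in>V. weighted_gauss_curvature \<phi> X u v = 0)"

text \<open>For an open set \<open>J\<close>, all iterated derivatives depend only on the restriction of \<open>f\<close> to \<open>J\<close>.\<close>
definition smooth_on :: "real set \<Rightarrow> (real \<Rightarrow> real) \<Rightarrow> bool" where
  "smooth_on J f \<longleftrightarrow> (\<forall>n. (deriv ^^ n) f differentiable_on J)"

definition rot_surface1 ::
    "(real \<Rightarrow> real) \<Rightarrow> (real \<Rightarrow> real) \<Rightarrow> real \<Rightarrow> real \<Rightarrow> surface" where
  "rot_surface1 f g \<alpha> \<beta> u v =
     vector [f u * cos (\<alpha> * v), f u * sin (\<alpha> * v), g u * cosh (\<beta> * v), g u * sinh (\<beta> * v)]"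

definition rot_surface2 ::
    "(real \<Rightarrow> real) \<Rightarrow> (real \<Rightarrow> real) \<Rightarrow> real \<Rightarrow> real \<Rightarrow> surface" where
  "rot_surface2 f g \<alpha> \<beta> u v =
     vector [f u * cos (\<alpha> * v), f u * sin (\<alpha> * v), g u * sinh (\<beta> * v), g u * cosh (\<beta> * v)]"

definition rot_surface ::
    "nat \<Rightarrow> (real \<Rightarrow> real) \<Rightarrow> (real \<Rightarrow> real) \<Rightarrow> real \<Rightarrow> real \<Rightarrow> surface" where
  "rot_surface i = (if i = 1 then rot_surface1 else rot_surface2)"

definition timelike_rot_data ::
    "nat \<Rightarrow> (real \<Rightarrow> real) \<Rightarrow> (real \<Rightarrow> real) \<Rightarrow> real \<Rightarrow> real \<Rightarrow> real set \<Rightarrow> bool" where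
  "timelike_rot_data i f g \<alpha> \<beta> J \<longleftrightarrow>
     (if i = 1
      then \<forall>u\<in>J. \<alpha>\<^sup>2 * (f u)\<^sup>2 - \<beta>\<^sup>2 * (g u)\<^sup>2 < 0 \<and> (deriv f u)\<^sup>2 + (deriv g u)\<^sup>2 > 0
      else \<forall>u\<in>J. (deriv f u)\<^sup>2 - (deriv g u)\<^sup>2 < 0 \<and> \<alpha>\<^sup>2 * (f u)\<^sup>2 + \<beta>\<^sup>2 * (g u)\<^sup>2 > 0)"

end

theory Submission
  imports Defs
begin

text \<open>
  The density contributes nothing: for a diagonal quadratic form the Laplacian is the constant
  \<open>2 (\<lambda>\<^sub>1 + \<lambda>\<^sub>2 + \<lambda>\<^sub>3 - \<lambda>\<^sub>4)\<close>, which the condition on the coefficients makes zero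
  (\<open>lorentz_laplacian_quadratic\<close>). So the weighted curvature is the ordinary Gaussian curvature, and
  it remains to see that the hypothesis is the vanishing of its numerator
  (\<open>gauss_curvature_rotation\<close>).

  Both types of surface are instances of one: in the \<open>(z, t)\<close>-plane the orbit is
  \<open>g (h, k)\<close> with \<open>h' = \<beta> k\<close>, \<open>k' = \<beta> h\<close>, and \<open>h\<^sup>2 - k\<^sup>2\<close> is the constant
  \<open>\<sigma> = - \<epsilon> = \<plusminus>1\<close>. All inner products of derivatives of the immersion depend on \<open>h, k\<close> only
  through \<open>\<sigma>\<close>. The coordinate lines are orthogonal, with
  \<open>E = f'\<^sup>2 + \<sigma> g'\<^sup>2\<close> and \<open>G = \<alpha>\<^sup>2 f\<^sup>2 - \<sigma> \<beta>\<^sup>2 g\<^sup>2\<close>. Since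
  \<open>X\<^sub>u\<^sub>u\<close> and \<open>X\<^sub>v\<^sub>v\<close> are orthogonal to \<open>X\<^sub>v\<close>, and \<open>X\<^sub>u\<^sub>v\<close> to \<open>X\<^sub>u\<close>, removing the tangential parts
  costs one term in each of the two products of the Gauss equation:
  \<open>\<langle>II\<^sub>u\<^sub>u, II\<^sub>v\<^sub>v\<rangle> = - \<sigma> (\<alpha>\<^sup>2 f g' + \<beta>\<^sup>2 g f') (f'' g' - f' g'') / E\<close> and
  \<open>\<langle>II\<^sub>u\<^sub>v, II\<^sub>u\<^sub>v\<rangle> = - \<sigma> \<alpha>\<^sup>2 \<beta>\<^sup>2 (g f' - f g')\<^sup>2 / G\<close>.
  Over the common denominator \<open>E G\<close>, their difference has the expression assumed to vanish as
  numerator. The conditions on the two timelike types make \<open>E\<close> and \<open>G\<close> nonzero.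
\<close>

section \<open>The Lorentzian product and the Laplacian\<close>

lemma lorentz_commute: "lorentz p q = lorentz q p"
  by (simp add: lorentz_def mult.commute)

lemma lorentz_diff_left: "lorentz (p - q) r = lorentz p r - lorentz q r"
  by (simp add: lorentz_def algebra_simps)

lemma lorentz_add_left: "lorentz (p + q) r = lorentz p r + lorentz q r"
  by (simp add: lorentz_def algebra_simps)

lemma lorentz_scaleR_left: "lorentz (c *\<^sub>R p) r = c * lorentz p r"
  by (simp add: lorentz_def algebra_simps)

lemma lorentz_diff_right: "lorentz r (p - q) = lorentz r p - lorentz r q"
  by (simp add: lorentz_def algebra_simps)

lemma lorentz_add_right: "lorentz r (p + q) = lorentz r p + lorentz r q"
  by (simp add: lorentz_def algebra_simps)

lemma lorentz_scaleR_right: "lorentz r (c *\<^sub>R p) = c * lorentz r p"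
  by (simp add: lorentz_def algebra_simps)

lemma vector_4:
  "(vector [a, b, c, d] :: 'a::zero ^ 4) $ 1 = a" "(vector [a, b, c, d] :: 'a ^ 4) $ 2 = b"
  "(vector [a, b, c, d] :: 'a ^ 4) $ 3 = c" "(vector [a, b, c, d] :: 'a ^ 4) $ 4 = d"
  by (simp_all add: vector_def)

lemma lorentz_vector:
  "lorentz (vector [a, b, c, d]) (vector [a', b', c', d']) = a * a' + b * b' + c * c' - d * d'"
  by (simp add: lorentz_def vector_4)

lemma partial_quadratic:
  fixes c :: "4 \<Rightarrow> real"
  shows "partial k (\<lambda>p. \<Sum>j\<in>UNIV. c j * (p $ j)\<^sup>2) = (\<lambda>p. 2 * c k * p $ k)"
proof
  fix p :: "real ^ 4"
  have "((\<lambda>s. \<Sum>j\<in>UNIV. c j * ((p + s *\<^sub>R axis k 1) $ j)\<^sup>2) has_real_derivative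
      (\<Sum>j\<in>UNIV. c j * (2 * p $ j * axis k 1 $ j))) (at 0)"
    by (auto intro!: derivative_eq_intros sum.cong)
  moreover have "(\<Sum>j\<in>UNIV. c j * (2 * p $ j * axis k 1 $ j))
      = (\<Sum>j\<in>UNIV. if j = k then 2 * c k * p $ k else 0)"
    by (rule sum.cong) (auto simp: axis_def)
  ultimately show "partial k (\<lambda>p. \<Sum>j\<in>UNIV. c j * (p $ j)\<^sup>2) p = 2 * c k * p $ k"
    unfolding partial_def by (simp add: DERIV_imp_deriv)
qed

lemma partial_linear: "partial k (\<lambda>p. c * p $ k) = (\<lambda>p. c)"
proof
  fix p :: "real ^ 4"
  have "((\<lambda>s. c * (p + s *\<^sub>R axis k 1) $ k) has_real_derivative c) (at 0)"
    by (auto intro!: derivative_eq_intros simp: axis_def)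
  then show "partial k (\<lambda>p. c * p $ k) p = c"
    unfolding partial_def by (rule DERIV_imp_deriv)
qed

lemma lorentz_laplacian_quadratic:
  "lorentz_laplacian (\<lambda>p. \<Sum>j\<in>UNIV. c j * (p $ j)\<^sup>2) p = 2 * (c 1 + c 2 + c 3 - c 4)"
  unfolding lorentz_laplacian_def partial_quadratic partial_linear by simp

section \<open>Normal parts in orthogonal coordinates\<close>

text \<open>
  Along orthogonal coordinate lines the projection to the tangent plane is the sum of the
  projections to the two lines; the normal part of \<open>w\<close> is orthogonal to both, so in the product
  the tangential part of \<open>w'\<close> drops out.
\<close>
lemma lorentz_normal_part:
  assumes "fund_F X u v = 0" and E: "fund_E X u v \<noteq> 0" and G: "fund_G X u v \<noteq> 0"
  shows "lorentz (normal_part X u v w) (normal_part X u v w') = lorentz w w'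
    - lorentz w (d_u X u v) * lorentz w' (d_u X u v) / fund_E X u v
    - lorentz w (d_v X u v) * lorentz w' (d_v X u v) / fund_G X u v"
proof -
  define a where "a = d_u X u v"
  define b where "b = d_v X u v"
  define E' where "E' = fund_E X u v"
  define G' where "G' = fund_G X u v"
  have aa: "lorentz a a = E'" and bb: "lorentz b b = G'"
    by (simp_all add: a_def b_def E'_def G'_def fund_E_def fund_G_def)
  have ab: "lorentz a b = 0" "lorentz b a = 0"
    using assms(1) by (simp_all add: a_def b_def fund_F_def lorentz_commute)
  have nz: "E' \<noteq> 0" "G' \<noteq> 0"
    using E G by (simp_all add: E'_def G'_def)
  have n: "normal_part X u v w = w - ((lorentz w a / E') *\<^sub>R a + (lorentz w b / G') *\<^sub>R b)" for w
    using assms unfolding normal_part_def fund_det_def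
    by (simp add: a_def b_def E'_def G'_def)
  have orth: "lorentz (normal_part X u v w) a = 0" "lorentz (normal_part X u v w) b = 0" for w
    unfolding n using nz
    by (simp_all add: lorentz_diff_left lorentz_add_left lorentz_scaleR_left aa bb ab)
  have "lorentz (normal_part X u v w) (normal_part X u v w') = lorentz (normal_part X u v w) w'"
    by (subst n[of w'])
      (simp add: lorentz_diff_right lorentz_add_right lorentz_scaleR_right orth)
  also have "\<dots> = lorentz w w' - lorentz w a * lorentz w' a / E' - lorentz w b * lorentz w' b / G'"
    unfolding n
    by (simp add: lorentz_diff_left lorentz_add_left lorentz_scaleR_left
        lorentz_commute[of a w'] lorentz_commute[of b w'])
  finally show ?thesis by (simp add: a_def b_def E'_def G'_def)
qed

section \<open>Rotational surfaces of both types\<close>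

lemma has_vector_derivative_vector4:
  assumes "(a has_real_derivative a') (at s)" "(b has_real_derivative b') (at s)"
    "(c has_real_derivative c') (at s)" "(d has_real_derivative d') (at s)"
  shows "((\<lambda>s. vector [a s, b s, c s, d s] :: real ^ 4) has_vector_derivative
    vector [a', b', c', d']) (at s)"
proof -
  have v: "(vector [x, y, z, t] :: real ^ 4)
      = x *\<^sub>R axis 1 1 + y *\<^sub>R axis 2 1 + z *\<^sub>R axis 3 1 + t *\<^sub>R axis 4 1" for x y z t
    by (simp add: vec_eq_iff forall_4 vector_4 axis_def)
  show ?thesis
    unfolding v using assms by (auto intro!: derivative_eq_intros)
qed

lemma smooth_on_has_derivatives:
  assumes "smooth_on J f" "open J" "u \<in> J"
  shows "(f has_real_derivative deriv f u) (at u)"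
    and "(deriv f has_real_derivative deriv (deriv f) u) (at u)"
proof -
  have "(deriv ^^ n) f field_differentiable at u" for n
    using assms unfolding smooth_on_def differentiable_on_def
    by (metis at_within_open real_differentiable_def field_differentiable_def)
  from this[of 0] this[of 1] show "(f has_real_derivative deriv f u) (at u)"
    "(deriv f has_real_derivative deriv (deriv f) u) (at u)"
    by (simp_all add: DERIV_deriv_iff_field_differentiable)
qed

text \<open>
  Keeping \<open>h, k\<close> abstract treats both types at once: \<open>(h, k)\<close> is \<open>(cosh, sinh)\<close> with \<open>\<sigma> = 1\<close> for
  the first type and \<open>(sinh, cosh)\<close> with \<open>\<sigma> = -1\<close> for the second.
\<close>
lemma gauss_curvature_rotation:
  fixes f g h k :: "real \<Rightarrow> real" and \<alpha> \<beta> \<sigma> u v :: real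
  defines "X \<equiv> \<lambda>u v. vector [f u * cos (\<alpha> * v), f u * sin (\<alpha> * v), g u * h v, g u * k v]"
  assumes J: "open J" "u \<in> J" and f: "smooth_on J f" and g: "smooth_on J g"
    and h: "\<And>v. (h has_real_derivative \<beta> * k v) (at v)"
    and k: "\<And>v. (k has_real_derivative \<beta> * h v) (at v)"
    and hk: "(h v)\<^sup>2 - (k v)\<^sup>2 = \<sigma>" and \<sigma>: "\<sigma>\<^sup>2 = 1"
    and E: "(deriv f u)\<^sup>2 + \<sigma> * (deriv g u)\<^sup>2 \<noteq> 0"
    and G: "(\<alpha> * f u)\<^sup>2 - \<sigma> * (\<beta> * g u)\<^sup>2 \<noteq> 0"
  shows "gauss_curvature X u v =
    (\<alpha>\<^sup>2 * \<beta>\<^sup>2 * (g u * deriv f u - f u * deriv g u)\<^sup>2 * (\<sigma> * (deriv f u)\<^sup>2 + (deriv g u)\<^sup>2)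
     + (- \<sigma> * (\<alpha> * f u)\<^sup>2 + (\<beta> * g u)\<^sup>2) * (\<beta>\<^sup>2 * g u * deriv f u + \<alpha>\<^sup>2 * f u * deriv g u)
         * (deriv (deriv f) u * deriv g u - deriv f u * deriv (deriv g) u))
    / (((\<alpha> * f u)\<^sup>2 - \<sigma> * (\<beta> * g u)\<^sup>2)\<^sup>2 * ((deriv f u)\<^sup>2 + \<sigma> * (deriv g u)\<^sup>2)\<^sup>2)"
proof -
  note df = smooth_on_has_derivatives[OF f J(1)] and dg = smooth_on_has_derivatives[OF g J(1)]
  let ?C = "cos (\<alpha> * v)" and ?S = "sin (\<alpha> * v)"
  define F0 F1 F2 where "F0 = f u" and "F1 = deriv f u" and "F2 = deriv (deriv f) u"
  define G0 G1 G2 where "G0 = g u" and "G1 = deriv g u" and "G2 = deriv (deriv g) u"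
  have Xu: "d_u X w v =
      vector [deriv f w * cos (\<alpha> * v), deriv f w * sin (\<alpha> * v), deriv g w * h v, deriv g w * k v]"
    if "w \<in> J" for w v
    unfolding d_u_def X_def
    by (rule vector_derivative_at has_vector_derivative_vector4)+
      (auto intro!: derivative_eq_intros df(1) dg(1) that)
  have Xv: "d_v X u v =
      vector [- \<alpha> * f u * sin (\<alpha> * v), \<alpha> * f u * cos (\<alpha> * v), \<beta> * g u * k v, \<beta> * g u * h v]" for u v
    unfolding d_v_def X_def
    by (rule vector_derivative_at has_vector_derivative_vector4)+
      (auto intro!: derivative_eq_intros h k)
  have Xuu: "d_u (d_u X) u v = vector [F2 * ?C, F2 * ?S, G2 * h v, G2 * k v]"
    unfolding d_u_def[of "d_u X"]
  proof (rule vector_derivative_at)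
    have "((\<lambda>s. vector [deriv f s * ?C, deriv f s * ?S, deriv g s * h v, deriv g s * k v] :: real^4)
        has_vector_derivative vector [F2 * ?C, F2 * ?S, G2 * h v, G2 * k v]) (at u)"
      unfolding F2_def G2_def
      by (rule has_vector_derivative_vector4)
        (auto intro!: derivative_eq_intros df(2) dg(2) J)
    then show "((\<lambda>s. d_u X s v) has_vector_derivative
        vector [F2 * ?C, F2 * ?S, G2 * h v, G2 * k v]) (at u)"
      by (rule has_vector_derivative_transform_within_open[OF _ J]) (simp add: Xu)
  qed
  have Xuv: "d_v (d_u X) u v = vector [- \<alpha> * F1 * ?S, \<alpha> * F1 * ?C, \<beta> * G1 * k v, \<beta> * G1 * h v]"
    unfolding d_v_def Xu[OF J(2)] F1_def G1_def
    by (rule vector_derivative_at has_vector_derivative_vector4)+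
      (auto intro!: derivative_eq_intros h k)
  have Xvv: "d_v (d_v X) u v =
      vector [- (\<alpha>\<^sup>2) * F0 * ?C, - (\<alpha>\<^sup>2) * F0 * ?S, \<beta>\<^sup>2 * G0 * h v, \<beta>\<^sup>2 * G0 * k v]"
    unfolding d_v_def[of "d_v X"] Xv F0_def G0_def
    by (rule vector_derivative_at has_vector_derivative_vector4)+
      (auto intro!: derivative_eq_intros h k simp: power2_eq_square)

  have cs: "?C\<^sup>2 = 1 - ?S\<^sup>2" by (simp add: cos_squared_eq)
  have hk': "(h v)\<^sup>2 = \<sigma> + (k v)\<^sup>2" using hk by simp
  note inner = lorentz_vector Xu[OF J(2), folded F1_def G1_def] Xv[of u, folded F0_def G0_def]
    Xuu Xuv Xvv
  define EE where "EE = F1\<^sup>2 + \<sigma> * G1\<^sup>2"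
  define GG where "GG = (\<alpha> * F0)\<^sup>2 - \<sigma> * (\<beta> * G0)\<^sup>2"
  have fE: "fund_E X u v = EE" and fF: "fund_F X u v = 0" and fG: "fund_G X u v = GG"
    unfolding fund_E_def fund_F_def fund_G_def inner EE_def GG_def
    subgoal using cs hk' by algebra
    subgoal by algebra
    subgoal using cs hk' by algebra
    done
  have nz: "EE \<noteq> 0" "GG \<noteq> 0"
    using E G by (simp_all add: EE_def GG_def F0_def F1_def G0_def G1_def)
  have uu_vv: "lorentz (d_u (d_u X) u v) (d_v (d_v X) u v) = - (\<alpha>\<^sup>2) * F0 * F2 + \<sigma> * \<beta>\<^sup>2 * G0 * G2"
    and uv_uv: "lorentz (d_v (d_u X) u v) (d_v (d_u X) u v) = \<alpha>\<^sup>2 * F1\<^sup>2 - \<sigma> * \<beta>\<^sup>2 * G1\<^sup>2"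
    and uu_u: "lorentz (d_u (d_u X) u v) (d_u X u v) = F1 * F2 + \<sigma> * G1 * G2"
    and uu_v: "lorentz (d_u (d_u X) u v) (d_v X u v) = 0"
    and uv_u: "lorentz (d_v (d_u X) u v) (d_u X u v) = 0"
    and uv_v: "lorentz (d_v (d_u X) u v) (d_v X u v) = \<alpha>\<^sup>2 * F0 * F1 - \<sigma> * \<beta>\<^sup>2 * G0 * G1"
    and vv_u: "lorentz (d_v (d_v X) u v) (d_u X u v) = - (\<alpha>\<^sup>2) * F0 * F1 + \<sigma> * \<beta>\<^sup>2 * G0 * G1"
    unfolding inner using cs hk' by algebra+

  \<comment> \<open>The terms with \<open>f f'' f'\<^sup>2\<close> and \<open>g g'' g'\<^sup>2\<close> cancel below; what is left of the
      \<open>uu\<close>-\<open>vv\<close> product factors as \<open>A B\<close>, and the \<open>uv\<close> product as the square in \<open>D\<close>.\<close>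
  define A where "A = \<alpha>\<^sup>2 * F0 * G1 + \<beta>\<^sup>2 * G0 * F1"
  define B where "B = F2 * G1 - F1 * G2"
  define D where "D = \<alpha>\<^sup>2 * \<beta>\<^sup>2 * (G0 * F1 - F0 * G1)\<^sup>2"
  have "lorentz (II_uu X u v) (II_vv X u v) = - \<alpha>\<^sup>2 * F0 * F2 + \<sigma> * \<beta>\<^sup>2 * G0 * G2
      - (F1 * F2 + \<sigma> * G1 * G2) * (- \<alpha>\<^sup>2 * F0 * F1 + \<sigma> * \<beta>\<^sup>2 * G0 * G1) / EE"
    unfolding II_uu_def II_vv_def
    by (subst lorentz_normal_part) (use nz in \<open>simp_all add: fE fF fG uu_vv uu_u uu_v vv_u\<close>)
  also have "\<dots> = ((- \<alpha>\<^sup>2 * F0 * F2 + \<sigma> * \<beta>\<^sup>2 * G0 * G2) * EE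
      - (F1 * F2 + \<sigma> * G1 * G2) * (- \<alpha>\<^sup>2 * F0 * F1 + \<sigma> * \<beta>\<^sup>2 * G0 * G1)) / EE"
    using nz by (simp add: diff_divide_distrib)
  also have "\<dots> = - \<sigma> * A * B / EE"
    unfolding EE_def A_def B_def
    by (intro arg_cong2[where f="(/)"] refl) (simp add: algebra_simps power2_eq_square)
  finally have II_uu_vv: "lorentz (II_uu X u v) (II_vv X u v) = - \<sigma> * A * B / EE" .

  have "lorentz (II_uv X u v) (II_uv X u v) = \<alpha>\<^sup>2 * F1\<^sup>2 - \<sigma> * \<beta>\<^sup>2 * G1\<^sup>2
      - (\<alpha>\<^sup>2 * F0 * F1 - \<sigma> * \<beta>\<^sup>2 * G0 * G1)\<^sup>2 / GG"
    unfolding II_uv_def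
    by (subst lorentz_normal_part)
      (use nz in \<open>simp_all add: fE fF fG uv_uv uv_u uv_v power2_eq_square\<close>)
  also have "\<dots> = ((\<alpha>\<^sup>2 * F1\<^sup>2 - \<sigma> * \<beta>\<^sup>2 * G1\<^sup>2) * GG
      - (\<alpha>\<^sup>2 * F0 * F1 - \<sigma> * \<beta>\<^sup>2 * G0 * G1)\<^sup>2) / GG"
    using nz by (simp add: diff_divide_distrib)
  also have "\<dots> = - \<sigma> * D / GG"
    unfolding GG_def D_def
    by (intro arg_cong2[where f="(/)"] refl) (simp add: algebra_simps power2_eq_square)
  finally have II_uv_uv: "lorentz (II_uv X u v) (II_uv X u v) = - \<sigma> * D / GG" .

  have "gauss_curvature X u v = (- \<sigma> * A * B / EE - (- \<sigma> * D / GG)) / (EE * GG)"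
    unfolding gauss_curvature_def fund_det_def II_uu_vv II_uv_uv fE fF fG by simp
  also have "\<dots> = (D * (\<sigma> * EE) + - \<sigma> * GG * A * B) / (GG\<^sup>2 * EE\<^sup>2)"
    using nz by (simp add: field_simps power2_eq_square)
  \<comment> \<open>Because \<open>\<sigma>\<^sup>2 = 1\<close>, the factor \<open>\<sigma>\<close> turns \<open>E\<close> and \<open>- G\<close> into the two quadratic
      expressions in the numerator.\<close>
  also have "\<sigma> * EE = \<sigma> * F1\<^sup>2 + G1\<^sup>2"
    unfolding EE_def using \<sigma> by algebra
  also have "- \<sigma> * GG = - \<sigma> * (\<alpha> * F0)\<^sup>2 + (\<beta> * G0)\<^sup>2"
    unfolding GG_def using \<sigma> by algebra
  finally show ?thesis
    unfolding A_def B_def D_def EE_def GG_def F0_def F1_def F2_def G0_def G1_def G2_def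
    by (simp add: add.commute)
qed

theorem corollary3:
  fixes i :: nat and \<epsilon> \<alpha> \<beta> l1 l2 l3 l4 :: real
    and f g :: "real \<Rightarrow> real" and J :: "real set"
  assumes "i \<in> {1, 2}" and "\<epsilon> = (- 1) ^ i"
    and "\<alpha> > 0" and "\<beta> > 0"
    and "open J" and "is_interval J"
    and "smooth_on J f" and "smooth_on J g"
    and "timelike_rot_data i f g \<alpha> \<beta> J"
    and "\<not> (l1 = 0 \<and> l2 = 0 \<and> l3 = 0 \<and> l4 = 0)"
    and "l1 + l2 + l3 = l4"
    and "\<forall>u\<in>J.
      \<alpha>\<^sup>2 * \<beta>\<^sup>2 * (g u * deriv f u - f u * deriv g u)\<^sup>2
          * (- \<epsilon> * (deriv f u)\<^sup>2 + (deriv g u)\<^sup>2)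
      + (\<epsilon> * (\<alpha> * f u)\<^sup>2 + (\<beta> * g u)\<^sup>2)
          * (\<beta>\<^sup>2 * g u * deriv f u + \<alpha>\<^sup>2 * f u * deriv g u)
          * (deriv (deriv f) u * deriv g u - deriv f u * deriv (deriv g) u) = 0"
  shows "weighted_flat
           (\<lambda>p. l1 * (p $ 1)\<^sup>2 + l2 * (p $ 2)\<^sup>2 + l3 * (p $ 3)\<^sup>2 + l4 * (p $ 4)\<^sup>2)
           (rot_surface i f g \<alpha> \<beta>) J {0..<2 * pi}"
proof -
  let ?c = "\<lambda>j :: 4. if j = 1 then l1 else if j = 2 then l2 else if j = 3 then l3 else l4"
  let ?\<phi> = "\<lambda>p :: real ^ 4. l1 * (p $ 1)\<^sup>2 + l2 * (p $ 2)\<^sup>2 + l3 * (p $ 3)\<^sup>2 + l4 * (p $ 4)\<^sup>2"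
  have "?\<phi> = (\<lambda>p. \<Sum>j\<in>UNIV. ?c j * (p $ j)\<^sup>2)"
    by (simp add: sum_4)
  then have lap: "lorentz_laplacian ?\<phi> p = 0" for p
    using \<open>l1 + l2 + l3 = l4\<close> lorentz_laplacian_quadratic[of ?c p] by simp
  have "gauss_curvature (rot_surface i f g \<alpha> \<beta>) u v = 0" if u: "u \<in> J" for u v
  proof -
    consider (first) "i = 1" "\<epsilon> = -1" | (second) "i = 2" "\<epsilon> = 1"
      using assms(1,2) by auto
    then show ?thesis
    proof cases
      case first
      have X: "rot_surface i f g \<alpha> \<beta> = (\<lambda>u v. vector [f u * cos (\<alpha> * v), f u * sin (\<alpha> * v),
          g u * cosh (\<beta> * v), g u * sinh (\<beta> * v)])"
        by (intro ext) (simp add: first rot_surface_def rot_surface1_def)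
      have nz: "(deriv f u)\<^sup>2 + 1 * (deriv g u)\<^sup>2 \<noteq> 0" "(\<alpha> * f u)\<^sup>2 - 1 * (\<beta> * g u)\<^sup>2 \<noteq> 0"
        using assms(9) u first by (auto simp: timelike_rot_data_def power_mult_distrib)
      show ?thesis
        unfolding X
        by (subst gauss_curvature_rotation[where \<sigma> = 1, OF \<open>open J\<close> u assms(7,8) _ _ _ _ nz])
          (use assms(12) u first in
            \<open>auto intro!: derivative_eq_intros simp: cosh_square_eq\<close>)
    next
      case second
      have X: "rot_surface i f g \<alpha> \<beta> = (\<lambda>u v. vector [f u * cos (\<alpha> * v), f u * sin (\<alpha> * v),
          g u * sinh (\<beta> * v), g u * cosh (\<beta> * v)])"
        by (intro ext) (simp add: second rot_surface_def rot_surface2_def)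
      have nz: "(deriv f u)\<^sup>2 + -1 * (deriv g u)\<^sup>2 \<noteq> 0" "(\<alpha> * f u)\<^sup>2 - -1 * (\<beta> * g u)\<^sup>2 \<noteq> 0"
        using assms(9) u second by (auto simp: timelike_rot_data_def power_mult_distrib)
      show ?thesis
        unfolding X
        by (subst gauss_curvature_rotation[where \<sigma> = "-1", OF \<open>open J\<close> u assms(7,8) _ _ _ _ nz])
          (use assms(12) u second in
            \<open>auto intro!: derivative_eq_intros simp: cosh_square_eq\<close>)
    qed
  qed
  then show ?thesis
    unfolding weighted_flat_def weighted_gauss_curvature_def lap by simp
qed

end
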